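(* Let $X$ be a complete metric space that is not locally compact, with $\mathrm{d}(X)=\mathrm{ld}(X)$. Let $G$ be a metrizable topological group. Assume that the local density of $X$ is realized, or that the cardinal number $\mathrm{ld}(X)$ has uncountable cofinality. (1) The topological group $\mathrm{C}(X,G)$ has a $\mathrm{Fin}(\mathrm{d}(X))^{\mathbb N}$-base. (2) If the group $G$ contains an arc, then the group $\mathrm{C}(X,G)$ has a local base at the identity element that is cofinally equivalent to $\mathrm{Fin}(\mathrm{d}(X))^{\mathbb N}$.
   Context: $\mathrm{C}(X,G)$ is the group of continuous functions from $X$ to $G$ with pointwise operations, equipped with the compact-open topology. An arc is a subspace homeomorphic to the unit interval $[0,1]$. For a topological group $H$, $\mathcal N(H)$ is the family of neighborhoods of the identity element, partially ordered by reverse inclusion $\supseteq$ (so smaller neighborhoods are larger in the order); local bases at the identity carry the same order. $\mathrm{d}(X)$ is the minimal cardinality of a dense subset of $X$. For a point $x\in X$, $\mathrm{ld}(x)$ is the minimal density of a neighborhood of $x$; the local density of $X$ is $\mathrm{ld}(X):=\sup_{x\in X}\mathrm{ld}(x)$; it is realized if there is $x\in X$ with $\mathrm{ld}(x)=\mathrm{ld}(X)$. For a set $S$, $\mathrm{Fin}(S)$ is the set of finite subsets of $S$, and $\mathrm{Fin}(S)^{\mathbb N}$ is the set of functions $f\colon\mathbb N\to\mathrm{Fin}(S)$, ordered by $f\le g$ iff $f(n)\subseteq g(n)$ for all $n$. A map $\psi\colon P\to Q$ of partially ordered sets is monotone if it preserves order, and cofinal if its image is cofinal in $Q$ (every $q\in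 Q$ satisfies $q\le\psi(p)$ for some $p\in P$). Write $P\preceq Q$ if there is a monotone cofinal map $P\to Q$; $P$ and $Q$ are cofinally equivalent, $P\approx Q$, if $P\preceq Q$ and $Q\preceq P$. For an infinite cardinal $\kappa$, a $\mathrm{Fin}(\kappa)^{\mathbb N}$-base of a topological group $H$ is the image of a monotone cofinal map from $\mathrm{Fin}(\kappa)^{\mathbb N}$ into $\mathcal N(H)$. *)

theory Defs
  imports "HOL-Analysis.Analysis"
begin

unbundle cardinal_syntax

section \<open>Cardinal invariants\<close>

text \<open>
  Cardinals are cardinal orders in the sense of the BNF cardinal theory, compared by
  \<open>\<le>o\<close> and \<open>=o\<close>.  All the minima below exist (see the lemmas), and a least cardinal
  is determined up to \<open>=o\<close>.  Every cardinal invariant of a space of type \<open>'a\<close> used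
  here is at most the cardinality of \<open>'a\<close>, so looking among the cardinals on \<open>'a\<close> is no
  restriction.
\<close>

definition least_card :: "('a rel \<Rightarrow> bool) \<Rightarrow> 'a rel" where
  "least_card P = (SOME r. Card_order r \<and> P r \<and> (\<forall>s. Card_order s \<and> P s \<longrightarrow> r \<le>o s))"

lemma least_card:
  assumes "Card_order r0" "P r0"
  shows "Card_order (least_card P)" "P (least_card P)"
    and "\<And>s. Card_order s \<Longrightarrow> P s \<Longrightarrow> least_card P \<le>o s"
proof -
  have "\<exists>r\<in>{r. Card_order r \<and> P r}. \<forall>s\<in>{r. Card_order r \<and> P r}. r \<le>o s"
    using assms by (intro exists_minim_Card_order) auto
  then have "\<exists>r. Card_order r \<and> P r \<and> (\<forall>s. Card_order s \<and> P s \<longrightarrow> r \<le>o s)"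
    by auto
  from someI_ex[OF this]
  show "Card_order (least_card P)" "P (least_card P)"
    "\<And>s. Card_order s \<Longrightarrow> P s \<Longrightarrow> least_card P \<le>o s"
    unfolding least_card_def by auto
qed

text \<open>The density \<open>d(A)\<close> of the subspace \<open>A\<close>.\<close>

definition dens :: "'a::topological_space set \<Rightarrow> 'a rel" where
  "dens A = least_card (\<lambda>r. \<exists>D. D \<subseteq> A \<and> A \<subseteq> closure D \<and> r =o |D| )"

text \<open>Neighborhoods need not be open.\<close>

definition local_density_at :: "'a::topological_space \<Rightarrow> 'a rel" where
  "local_density_at x = least_card (\<lambda>r. \<exists>N. x \<in> interior N \<and> r =o dens N)"

text \<open>The supremum of a family of cardinals is its least upper bound.\<close>

definition local_density :: "'a::topological_space rel" where
  "local_density = least_card (\<lambda>r. \<forall>x::'a. local_density_at x \<le>o r)"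

definition local_density_realized :: "'a::topological_space itself \<Rightarrow> bool" where
  "local_density_realized _ \<longleftrightarrow> (\<exists>x::'a. local_density_at x =o (local_density :: 'a rel))"

definition cofinality :: "'a rel \<Rightarrow> 'a rel" where
  "cofinality r =
    least_card (\<lambda>s. \<exists>A. A \<subseteq> Field r \<and> (\<forall>a\<in>Field r. \<exists>b\<in>A. (a, b) \<in> r) \<and> s =o |A| )"

definition uncountable_cofinality :: "'a rel \<Rightarrow> bool" where
  "uncountable_cofinality r \<longleftrightarrow> natLeq <o cofinality r"

lemma dens_props:
  fixes A :: "'a::topological_space set"
  shows Card_order_dens: "Card_order (dens A)"
    and dens_attained: "\<exists>D. D \<subseteq> A \<and> A \<subseteq> closure D \<and> dens A =o |D|"
    and dens_least: "\<And>D. D \<subseteq> A \<Longrightarrow> A \<subseteq> closure D \<Longrightarrow> dens A \<le>o |D|"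
proof -
  let ?P = "\<lambda>r::'a rel. \<exists>D. D \<subseteq> A \<and> A \<subseteq> closure D \<and> r =o |D|"
  have A: "?P |A|"
    by (intro exI[of _ A]) (auto simp: closure_subset card_of_refl intro: subsetD[OF closure_subset])
  note * = least_card[of "|A|" ?P, OF card_of_Card_order A, folded dens_def]
  show "Card_order (dens A)" "\<exists>D. D \<subseteq> A \<and> A \<subseteq> closure D \<and> dens A =o |D|"
    using * by auto
  show "dens A \<le>o |D|" if "D \<subseteq> A" "A \<subseteq> closure D" for D
    using that by (intro *(3)) (auto simp: card_of_refl card_of_Card_order)
qed

lemma local_density_at_props:
  fixes x :: "'a::topological_space"
  shows Card_order_local_density_at: "Card_order (local_density_at x)"
    and local_density_at_attained: "\<exists>N. x \<in> interior N \<and> local_density_at x =o dens N"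
    and local_density_at_least: "\<And>N. x \<in> interior N \<Longrightarrow> local_density_at x \<le>o dens N"
proof -
  let ?P = "\<lambda>r::'a rel. \<exists>N. x \<in> interior N \<and> r =o dens N"
  have U: "?P (dens UNIV)"
    by (intro exI[of _ UNIV]) (auto intro: ordIso_refl Card_order_dens)
  note * = least_card[of "dens UNIV" ?P, OF Card_order_dens U, folded local_density_at_def]
  show "Card_order (local_density_at x)"
    "\<exists>N. x \<in> interior N \<and> local_density_at x =o dens N"
    using * by auto
  show "local_density_at x \<le>o dens N" if "x \<in> interior N" for N
    using that by (intro *(3)) (auto intro: ordIso_refl Card_order_dens)
qed

lemma local_density_props:
  shows Card_order_local_density: "Card_order (local_density :: 'a::topological_space rel)"
    and local_density_upper: "\<And>x::'a. local_density_at x \<le>o (local_density :: 'a rel)"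
    and local_density_least:
      "\<And>r :: 'b rel. Card_order r \<Longrightarrow> (\<And>x::'a. local_density_at x \<le>o r)
        \<Longrightarrow> (local_density :: 'a rel) \<le>o r"
proof -
  let ?P = "\<lambda>r::'a rel. \<forall>x::'a. local_density_at x \<le>o r"
  have U: "?P |UNIV|"
    using ordIso_ordLeq_trans[OF ordIso_symmetric[OF card_of_Field_ordIso] card_of_mono1[OF subset_UNIV]]
      Card_order_local_density_at by blast
  note * = least_card[of "|UNIV|" ?P, OF card_of_Card_order U, folded local_density_def]
  show "Card_order (local_density :: 'a rel)" "\<And>x::'a. local_density_at x \<le>o (local_density :: 'a rel)"
    using * by auto
  show "(local_density :: 'a rel) \<le>o r"
    if r: "Card_order r" "\<And>x::'a. local_density_at x \<le>o r" for r :: "'b rel"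
  proof (cases "r \<le>o |UNIV :: 'a set|")
    case True
    then obtain s :: "'a rel" where s: "r =o s"
      using internalize_ordLeq[of r "|UNIV :: 'a set|"] by blast
    have "Card_order s"
      using s r(1) Card_order_ordIso2 by blast
    moreover have "?P s"
      using r(2) s ordLeq_ordIso_trans by blast
    ultimately show ?thesis
      using *(3) s ordLeq_ordIso_trans ordIso_symmetric by blast
  next
    case False
    then have "|UNIV :: 'a set| \<le>o r"
      using r(1) by (meson card_of_Well_order card_order_on_well_order_on ordLeq_total)
    moreover have "(local_density :: 'a rel) \<le>o |UNIV :: 'a set|"
      using *(3)[OF card_of_Card_order U] .
    ultimately show ?thesis
      using ordLeq_transitive by blast
  qed
qed

lemma cofinality_props:
  fixes r :: "'a rel"
  assumes "Card_order r"
  shows Card_order_cofinality: "Card_order (cofinality r)"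
    and cofinality_attained:
      "\<exists>A. A \<subseteq> Field r \<and> (\<forall>a\<in>Field r. \<exists>b\<in>A. (a, b) \<in> r) \<and> cofinality r =o |A|"
    and cofinality_least:
      "\<And>A. A \<subseteq> Field r \<Longrightarrow> \<forall>a\<in>Field r. \<exists>b\<in>A. (a, b) \<in> r \<Longrightarrow> cofinality r \<le>o |A|"
proof -
  let ?P = "\<lambda>s::'a rel. \<exists>A. A \<subseteq> Field r \<and> (\<forall>a\<in>Field r. \<exists>b\<in>A. (a, b) \<in> r) \<and> s =o |A|"
  have "Refl r"
    using assms by (auto simp: card_order_on_def well_order_on_def linear_order_on_def
        partial_order_on_def preorder_on_def)
  then have F: "?P |Field r|"
    by (intro exI[of _ "Field r"]) (auto simp: refl_on_def card_of_refl)
  note * = least_card[of "|Field r|" ?P, OF card_of_Card_order F, folded cofinality_def]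
  show "Card_order (cofinality r)"
    "\<exists>A. A \<subseteq> Field r \<and> (\<forall>a\<in>Field r. \<exists>b\<in>A. (a, b) \<in> r) \<and> cofinality r =o |A|"
    using * by auto
  show "cofinality r \<le>o |A|"
    if "A \<subseteq> Field r" "\<forall>a\<in>Field r. \<exists>b\<in>A. (a, b) \<in> r" for A
    using that by (intro *(3)) (auto simp: card_of_refl card_of_Card_order)
qed


section \<open>Monotone cofinal maps\<close>

text \<open>A partially ordered set is given by its carrier and its order relation.\<close>

definition monotone_cofinal ::
    "'p set \<Rightarrow> ('p \<Rightarrow> 'p \<Rightarrow> bool) \<Rightarrow> 'q set \<Rightarrow> ('q \<Rightarrow> 'q \<Rightarrow> bool) \<Rightarrow> ('p \<Rightarrow> 'q) \<Rightarrow> bool" where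
  "monotone_cofinal P leP Q leQ \<psi> \<longleftrightarrow>
     \<psi> ` P \<subseteq> Q \<and> monotone_on P leP leQ \<psi> \<and> (\<forall>q\<in>Q. \<exists>p\<in>P. leQ q (\<psi> p))"

definition cofinal_le ::
    "'p set \<Rightarrow> ('p \<Rightarrow> 'p \<Rightarrow> bool) \<Rightarrow> 'q set \<Rightarrow> ('q \<Rightarrow> 'q \<Rightarrow> bool) \<Rightarrow> bool" where
  "cofinal_le P leP Q leQ \<longleftrightarrow> (\<exists>\<psi>. monotone_cofinal P leP Q leQ \<psi>)"

definition cofinally_equivalent ::
    "'p set \<Rightarrow> ('p \<Rightarrow> 'p \<Rightarrow> bool) \<Rightarrow> 'q set \<Rightarrow> ('q \<Rightarrow> 'q \<Rightarrow> bool) \<Rightarrow> bool" where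
  "cofinally_equivalent P leP Q leQ \<longleftrightarrow> cofinal_le P leP Q leQ \<and> cofinal_le Q leQ P leP"

text \<open>
  The carrier of \<open>Fin(\<kappa>)\<^sup>\<nat>\<close>, where a cardinal order \<open>\<kappa>\<close> is identified with its field, a
  set of cardinality \<open>\<kappa>\<close>.  The intended order is the library order \<open>(\<le>)\<close> on
  \<open>nat \<Rightarrow> 'k set\<close>, which is pointwise inclusion.
\<close>

definition Fin_seq :: "'k rel \<Rightarrow> (nat \<Rightarrow> 'k set) set" where
  "Fin_seq \<kappa> = {f. \<forall>n. finite (f n) \<and> f n \<subseteq> Field \<kappa>}"


section \<open>Bases at the identity of a topological group\<close>

text \<open>
  Groups are written additively but are not assumed to be commutative.  Families of
  neighborhoods are ordered by reverse inclusion.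
\<close>

definition nhds_id :: "'h::topological_group_add set set" where
  "nhds_id = {N. 0 \<in> interior N}"

definition local_base_id :: "'h::topological_group_add set set \<Rightarrow> bool" where
  "local_base_id \<B> \<longleftrightarrow> \<B> \<subseteq> nhds_id \<and> (\<forall>N\<in>nhds_id. \<exists>V\<in>\<B>. V \<subseteq> N)"

definition Fin_seq_base :: "'k rel \<Rightarrow> 'h::topological_group_add set set \<Rightarrow> bool" where
  "Fin_seq_base \<kappa> \<B> \<longleftrightarrow>
     (\<exists>\<psi>. monotone_cofinal (Fin_seq \<kappa>) (\<le>) nhds_id (\<supseteq>) \<psi> \<and> \<B> = \<psi> ` Fin_seq \<kappa>)"


section \<open>The topological group of continuous functions\<close>

typedef (overloaded) ('a, 'g) cfun =
  "{f :: 'a::topological_space \<Rightarrow> 'g::topological_space. continuous_on UNIV f}"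
  morphisms apply_cfun Cfun
  by (rule exI[of _ "\<lambda>_. undefined"]) auto

setup_lifting type_definition_cfun

lemma continuous_on_apply_cfun [continuous_intros]: "continuous_on S (apply_cfun f)"
  using apply_cfun[of f] continuous_on_subset by auto

text \<open>The compact-open topology.\<close>

instantiation cfun :: (topological_space, topological_space) topological_space
begin

definition open_cfun :: "('a, 'b) cfun set \<Rightarrow> bool" where
  "open_cfun = generate_topology {{f. apply_cfun f ` K \<subseteq> U} | K U. compact K \<and> open U}"

instance
  by standard (auto simp: open_cfun_def intro: generate_topology.intros)

end

instantiation cfun :: (topological_space, topological_group_add) group_add
begin

lift_definition zero_cfun :: "('a, 'b) cfun" is "\<lambda>_. 0"
  by simp

lift_definition plus_cfun :: "('a, 'b) cfun \<Rightarrow> ('a, 'b) cfun \<Rightarrow> ('a, 'b) cfun"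
  is "\<lambda>f g x. f x + g x"
  by (intro continuous_intros)

lift_definition uminus_cfun :: "('a, 'b) cfun \<Rightarrow> ('a, 'b) cfun" is "\<lambda>f x. - f x"
  by (simp add: continuous_on_def tendsto_minus)

definition minus_cfun :: "('a, 'b) cfun \<Rightarrow> ('a, 'b) cfun \<Rightarrow> ('a, 'b) cfun" where
  "minus_cfun f g = f + - g"

instance
  by standard (simp_all add: minus_cfun_def, (transfer, simp add: add.assoc)+)

end

lemma open_cfun_subbasic:
  assumes "compact K" "open U"
  shows "open {f. apply_cfun f ` K \<subseteq> U}"
  unfolding open_cfun_def using assms by (intro generate_topology.Basis) blast

lemma tendsto_cfunI:
  assumes "\<And>K U. compact K \<Longrightarrow> open U \<Longrightarrow> apply_cfun h ` K \<subseteq> U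
    \<Longrightarrow> \<forall>\<^sub>F p in F. apply_cfun (\<phi> p) ` K \<subseteq> U"
  shows "(\<phi> \<longlongrightarrow> h) F"
proof (rule topological_tendstoI)
  fix S assume "open S" "h \<in> S"
  from this(1)[unfolded open_cfun_def] this(2)
  show "\<forall>\<^sub>F p in F. \<phi> p \<in> S"
  proof (induction S)
    case UNIV
    then show ?case by simp
  next
    case (Int A B)
    then show ?case by (simp add: eventually_conj)
  next
    case (UN \<K>)
    then obtain A where A: "A \<in> \<K>" "h \<in> A" by blast
    then have "\<forall>\<^sub>F p in F. \<phi> p \<in> A" using UN by blast
    then show ?case using A by (auto elim: eventually_mono)
  next
    case (Basis S)
    then show ?case using assms by auto
  qed
qed

instance cfun :: (metric_space, topological_group_add) topological_group_add
proof
  fix f g :: "('a, 'b) cfun"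
  show "LIM p (nhds f \<times>\<^sub>F nhds g). fst p + snd p :> nhds (f + g)"
  proof (rule tendsto_cfunI)
    fix K :: "'a set" and U :: "'b set"
    assume K: "compact K" and U: "open U" and KU: "apply_cfun (f + g) ` K \<subseteq> U"
    define P where "P x e V W \<longleftrightarrow> e > 0 \<and> open V \<and> open W \<and> (\<forall>v\<in>V. \<forall>w\<in>W. v + w \<in> U) \<and>
        apply_cfun f ` cball x e \<subseteq> V \<and> apply_cfun g ` cball x e \<subseteq> W" for x e V W
    have ex: "\<exists>e V W. P x e V W" if x: "x \<in> K" for x
    proof -
      have "apply_cfun f x + apply_cfun g x \<in> U"
        using x KU by (auto simp: plus_cfun.rep_eq)
      then have "\<forall>\<^sub>F p in nhds (apply_cfun f x) \<times>\<^sub>F nhds (apply_cfun g x). fst p + snd p \<in> U"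
        using tendsto_add_Pair U topological_tendstoD by blast
      then obtain Pf Pg where Pf: "eventually Pf (nhds (apply_cfun f x))"
        and Pg: "eventually Pg (nhds (apply_cfun g x))"
        and PQ: "\<And>v w. Pf v \<Longrightarrow> Pg w \<Longrightarrow> v + w \<in> U"
        unfolding eventually_prod_filter fst_conv snd_conv by blast
      obtain V where V: "open V" "apply_cfun f x \<in> V" "\<And>v. v \<in> V \<Longrightarrow> Pf v"
        using Pf unfolding eventually_nhds by blast
      obtain W where W: "open W" "apply_cfun g x \<in> W" "\<And>w. w \<in> W \<Longrightarrow> Pg w"
        using Pg unfolding eventually_nhds by blast
      have VW: "open V" "open W" "apply_cfun f x \<in> V" "apply_cfun g x \<in> W"
          "\<forall>v\<in>V. \<forall>w\<in>W. v + w \<in> U"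
        using V W PQ by simp_all
      have "open (apply_cfun f -` V \<inter> apply_cfun g -` W)"
        using VW continuous_on_apply_cfun[of UNIV]
        by (intro open_Int) (auto intro: open_vimage)
      moreover have "x \<in> apply_cfun f -` V \<inter> apply_cfun g -` W"
        using VW by simp
      ultimately obtain e where e: "e > 0" "cball x e \<subseteq> apply_cfun f -` V \<inter> apply_cfun g -` W"
        by (meson open_contains_cball)
      then have "apply_cfun f ` cball x e \<subseteq> V" "apply_cfun g ` cball x e \<subseteq> W"
        by blast+
      with e VW have "P x e V W"
        unfolding P_def by simp
      then show ?thesis by blast
    qed
    then obtain e V W where P: "\<And>x. x \<in> K \<Longrightarrow> P x (e x) (V x) (W x)"
      by metis
    have e: "\<And>x. x \<in> K \<Longrightarrow> e x > 0" using P by (simp add: P_def)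
    have VW: "\<And>x. x \<in> K \<Longrightarrow> open (V x)" "\<And>x. x \<in> K \<Longrightarrow> open (W x)"
        "\<And>x v w. x \<in> K \<Longrightarrow> v \<in> V x \<Longrightarrow> w \<in> W x \<Longrightarrow> v + w \<in> U"
        "\<And>x. x \<in> K \<Longrightarrow> apply_cfun f ` cball x (e x) \<subseteq> V x"
        "\<And>x. x \<in> K \<Longrightarrow> apply_cfun g ` cball x (e x) \<subseteq> W x"
      using P by (simp_all add: P_def)
    have "K \<subseteq> (\<Union>x\<in>K. ball x (e x))"
      using e by force
    then obtain T where T: "T \<subseteq> K" "finite T" "K \<subseteq> (\<Union>x\<in>T. ball x (e x))"
      using compactE_image[OF K, of K "\<lambda>x. ball x (e x)"] by blast
    let ?K = "\<lambda>x. K \<inter> cball x (e x)"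
    have cK: "compact (?K x)" for x
      using K by (simp add: compact_Int_closed)
    have 1: "\<forall>\<^sub>F f' in nhds f. \<forall>x\<in>T. apply_cfun f' ` ?K x \<subseteq> V x"
    proof (intro eventually_ball_finite[OF T(2)] ballI)
      fix x assume "x \<in> T"
      then have x: "x \<in> K" using T by blast
      have "open {f'. apply_cfun f' ` ?K x \<subseteq> V x}"
        by (intro open_cfun_subbasic cK VW x)
      moreover have "f \<in> {f'. apply_cfun f' ` ?K x \<subseteq> V x}" using VW(4)[OF x] by auto
      ultimately show "\<forall>\<^sub>F f' in nhds f. apply_cfun f' ` ?K x \<subseteq> V x"
        using eventually_nhds_in_open by fastforce
    qed
    have 2: "\<forall>\<^sub>F g' in nhds g. \<forall>x\<in>T. apply_cfun g' ` ?K x \<subseteq> W x"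
    proof (intro eventually_ball_finite[OF T(2)] ballI)
      fix x assume "x \<in> T"
      then have x: "x \<in> K" using T by blast
      have "open {f'. apply_cfun f' ` ?K x \<subseteq> W x}"
        by (intro open_cfun_subbasic cK VW x)
      moreover have "g \<in> {f'. apply_cfun f' ` ?K x \<subseteq> W x}" using VW(5)[OF x] by auto
      ultimately show "\<forall>\<^sub>F f' in nhds g. apply_cfun f' ` ?K x \<subseteq> W x"
        using eventually_nhds_in_open by fastforce
    qed
    have sub: "apply_cfun (f' + g') ` K \<subseteq> U"
      if f': "\<forall>x\<in>T. apply_cfun f' ` ?K x \<subseteq> V x" and g': "\<forall>x\<in>T. apply_cfun g' ` ?K x \<subseteq> W x"
      for f' g' :: "('a, 'b) cfun"
    proof (rule image_subsetI)
      fix y assume y: "y \<in> K"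
      then obtain x where x: "x \<in> T" "y \<in> ball x (e x)" using T by blast
      then have "y \<in> ?K x" using y by auto
      then have "apply_cfun f' y \<in> V x" "apply_cfun g' y \<in> W x" using f' g' x by blast+
      then show "apply_cfun (f' + g') y \<in> U"
        using VW(3) x T by (auto simp: plus_cfun.rep_eq)
    qed
    show "\<forall>\<^sub>F p in nhds f \<times>\<^sub>F nhds g. apply_cfun (fst p + snd p) ` K \<subseteq> U"
      unfolding eventually_prod_filter
      by (intro exI conjI, rule 1, rule 2)
        (intro allI impI, unfold fst_conv snd_conv, rule sub)
  qed
next
  fix f :: "('a, 'b) cfun"
  show "(uminus \<longlongrightarrow> - f) (nhds f)"
  proof (rule tendsto_cfunI)
    fix K :: "'a set" and U :: "'b set"
    assume K: "compact K" and U: "open U" and KU: "apply_cfun (- f) ` K \<subseteq> U"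
    have "continuous_on UNIV (uminus :: 'b \<Rightarrow> 'b)"
      by (simp add: continuous_on_def tendsto_minus)
    then have "open ((uminus :: 'b \<Rightarrow> 'b) -` U)"
      using U open_vimage by blast
    then have "open {g. apply_cfun g ` K \<subseteq> (uminus :: 'b \<Rightarrow> 'b) -` U}"
      using K by (intro open_cfun_subbasic)
    moreover have "f \<in> {g. apply_cfun g ` K \<subseteq> (uminus :: 'b \<Rightarrow> 'b) -` U}"
      using KU by (auto simp: uminus_cfun.rep_eq)
    ultimately have "\<forall>\<^sub>F g in nhds f. g \<in> {g. apply_cfun g ` K \<subseteq> (uminus :: 'b \<Rightarrow> 'b) -` U}"
      by (rule eventually_nhds_in_open)
    then show "\<forall>\<^sub>F g in nhds f. apply_cfun (- g) ` K \<subseteq> U"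
      by eventually_elim (auto simp: uminus_cfun.rep_eq)
  qed
qed

end

theory Submission
  imports Defs "HOL-Library.Countable_Set_Type"
begin

text \<open>
  Let \<open>\<kappa>\<close> be the density of \<open>X\<close> and write \<open>K(X)\<close> for the compact subsets of \<open>X\<close> ordered by
  inclusion.  The zero neighborhoods of \<open>C(X,G)\<close> are governed by pairs of a compact set \<open>K\<close> and
  a zero neighborhood \<open>U\<close> of \<open>G\<close>, through the sets \<open>[K,U]\<close> of functions that map \<open>K\<close> into \<open>U\<close>.
  The theorem thus compares such pairs with \<open>Fin(\<kappa>)\<^sup>\<nat>\<close>.

  From \<open>Fin(\<kappa>)\<^sup>\<nat>\<close> to neighborhoods (\<open>Fin_seq_cofinal_to_nhds\<close>): in a complete space the compact
  sets are, up to enlargement, the intersections over \<open>n\<close> of finite unions of balls of radius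
  \<open>1/(n+1)\<close> around points of a fixed dense set of size \<open>\<kappa>\<close>.  A sequence of finite sets of
  centres describes such a compact set.  One further finite set codes, by its cardinality, a
  member of a decreasing sequence of zero neighborhoods of \<open>G\<close>.

  From neighborhoods to \<open>K(X)\<close> (\<open>nhds_cofinal_to_compact_sets\<close>): a neighborhood \<open>N\<close> determines
  the set of points near which a function that vanishes elsewhere can fail to be in \<open>N\<close>.  It is
  compact and grows as \<open>N\<close> shrinks.  A nontrivial path in \<open>G\<close> supplies bump functions, and they
  show that every compact set is contained in one that arises in this way.

  From \<open>K(X)\<close> to \<open>Fin(\<kappa>)\<^sup>\<nat>\<close> (\<open>compact_sets_cofinal_to_finite_sequences\<close>): finite information is
  read off a compact set \<open>K\<close> by intersecting it with closed discrete sets.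
  If a point \<open>x\<close> has local density \<open>\<kappa>\<close>, then each ball \<open>B(x,1/(n+1))\<close> contains a dense set of
  at least \<open>\<kappa>\<close> points that is a countable union of closed discrete layers, and the trace of
  \<open>K\<close> on these layers yields the \<open>n\<close>-th finite set.  The choice of one finite set for each \<open>n\<close>
  is free, since finite subsets of shrinking balls around \<open>x\<close> form a compact set together with
  \<open>x\<close>.  Only finitely many layers may be used, and their number must depend monotonically on \<open>K\<close>.
  Here a point \<open>p\<close> without compact neighborhoods enters: every ball around \<open>p\<close> contains an
  infinite closed discrete set \<open>S n\<close>, so that the number of points of \<open>K\<close> in \<open>S n\<close> is a counter
  that can be set at will.

  If no point has local density \<open>\<kappa>\<close> but \<open>\<kappa>\<close> has uncountable cofinality, then a sequence of
  finite subsets of \<open>\<kappa>\<close> lives in a proper initial segment of \<open>\<kappa>\<close>, and for every such segment there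
  is a point whose local density is large enough for the construction above.  It remains to
  let \<open>K\<close> select the segment: the segments are indexed by a dense subset of \<open>X\<close>, again a
  union of closed discrete layers, so that \<open>K\<close> selects finitely many of them.
\<close>

section \<open>Closed discrete layers\<close>

text \<open>In a metric space these are exactly the closed discrete sets.\<close>

definition compact_finite :: "'a::topological_space set \<Rightarrow> bool" where
  "compact_finite E \<longleftrightarrow> (\<forall>K. compact K \<longrightarrow> finite (K \<inter> E))"

lemma separated_imp_compact_finite:
  fixes S :: "'a::metric_space set"
  assumes "e > 0" and sep: "\<And>x y. x \<in> S \<Longrightarrow> y \<in> S \<Longrightarrow> x \<noteq> y \<Longrightarrow> e \<le> dist x y"
  shows "compact_finite S"
  unfolding compact_finite_def
proof (intro allI impI)
  fix K :: "'a set"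
  assume K: "compact K"
  have "\<forall>e>0. \<exists>c. finite c \<and> K \<subseteq> (\<Union>x\<in>c. ball x e)"
    using K by (simp add: compact_eq_totally_bounded)
  from this[rule_format, OF half_gt_zero[OF \<open>e > 0\<close>]]
  obtain c where c: "finite c" "K \<subseteq> (\<Union>x\<in>c. ball x (e/2))"
    by blast
  have "finite (ball x (e/2) \<inter> S)" for x
  proof -
    have "y = z" if "y \<in> ball x (e/2) \<inter> S" "z \<in> ball x (e/2) \<inter> S" for y z
    proof (rule ccontr)
      assume "y \<noteq> z"
      then have "e \<le> dist y z" using sep that by blast
      moreover have "dist y z < e"
        using that dist_triangle[of y z x] by (simp add: dist_commute)
      ultimately show False by simp
    qed
    then have "\<exists>y. ball x (e/2) \<inter> S \<subseteq> {y}" by blast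
    then show ?thesis by (meson finite.emptyI finite.insertI finite_subset)
  qed
  then have "finite (\<Union>x\<in>c. ball x (e/2) \<inter> S)" using c by blast
  moreover have "K \<inter> S \<subseteq> (\<Union>x\<in>c. ball x (e/2) \<inter> S)" using c by blast
  ultimately show "finite (K \<inter> S)" by (rule rev_finite_subset)
qed

lemma maximal_separated_subset:
  fixes A :: "'a::metric_space set"
  assumes "e > 0"
  obtains S where "S \<subseteq> A" "\<And>x y. x \<in> S \<Longrightarrow> y \<in> S \<Longrightarrow> x \<noteq> y \<Longrightarrow> e \<le> dist x y"
    "\<And>a. a \<in> A \<Longrightarrow> \<exists>s\<in>S. dist s a < e"
proof -
  define \<A> where "\<A> = {S. S \<subseteq> A \<and> (\<forall>x\<in>S. \<forall>y\<in>S. x \<noteq> y \<longrightarrow> e \<le> dist x y)}"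
  have "\<exists>M\<in>\<A>. \<forall>X\<in>\<A>. M \<subseteq> X \<longrightarrow> X = M"
  proof (rule subset_Zorn')
    fix C assume C: "subset.chain \<A> C"
    have "e \<le> dist x y" if "x \<in> X" "X \<in> C" "y \<in> Y" "Y \<in> C" "x \<noteq> y" for x y X Y
    proof -
      have "X \<subseteq> Y \<or> Y \<subseteq> X" using C that unfolding subset.chain_def by blast
      moreover have "X \<in> \<A>" "Y \<in> \<A>" using C that unfolding subset.chain_def by blast+
      ultimately show ?thesis using that unfolding \<A>_def by blast
    qed
    moreover have "\<Union>C \<subseteq> A" using C unfolding subset.chain_def \<A>_def by blast
    ultimately show "\<Union>C \<in> \<A>" unfolding \<A>_def by blast
  qed
  then obtain S where S: "S \<in> \<A>" and max: "\<And>X. X \<in> \<A> \<Longrightarrow> S \<subseteq> X \<Longrightarrow> X = S" by blast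
  have near: "\<exists>s\<in>S. dist s a < e" if a: "a \<in> A" for a
  proof (rule ccontr)
    assume "\<not> ?thesis"
    then have far: "e \<le> dist s a" if "s \<in> S" for s using that by force
    then have "insert a S \<in> \<A>"
      using S a unfolding \<A>_def by (auto simp: dist_commute)
    then have "a \<in> S" using max by blast
    then show False using far[of a] \<open>e > 0\<close> by simp
  qed
  show ?thesis
  proof (rule that)
    show "S \<subseteq> A" "\<And>x y. x \<in> S \<Longrightarrow> y \<in> S \<Longrightarrow> x \<noteq> y \<Longrightarrow> e \<le> dist x y"
      using S unfolding \<A>_def by blast+
  qed (rule near)
qed

text \<open>
  A space of uncountable density \<open>\<kappa>\<close> need not contain a closed discrete set of size \<open>\<kappa>\<close> if
  \<open>\<kappa>\<close> has countable cofinality.  Maximal separated sets, one for each scale, have a dense union, which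
  therefore has at least \<open>\<kappa>\<close> points.
\<close>

lemma dense_layers:
  fixes A :: "'a::metric_space set"
  shows "\<exists>E :: nat \<Rightarrow> 'a set. (\<forall>k. E k \<subseteq> A) \<and> (\<forall>k. compact_finite (E k)) \<and>
    A \<subseteq> closure (\<Union>k. E k)"
proof -
  have "\<exists>S. S \<subseteq> A \<and> compact_finite S \<and> (\<forall>a\<in>A. \<exists>s\<in>S. dist s a < inverse (real (Suc k)))" for k
  proof -
    have pos: "inverse (real (Suc k)) > 0" by simp
    obtain S where S: "S \<subseteq> A"
        "\<And>x y. x \<in> S \<Longrightarrow> y \<in> S \<Longrightarrow> x \<noteq> y \<Longrightarrow> inverse (real (Suc k)) \<le> dist x y"
        "\<And>a. a \<in> A \<Longrightarrow> \<exists>s\<in>S. dist s a < inverse (real (Suc k))"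
      using maximal_separated_subset[OF pos, of A] by metis
    have "compact_finite S" by (rule separated_imp_compact_finite[OF pos S(2)])
    then show ?thesis using S(1,3) by (intro exI[of _ S] conjI ballI)
  qed
  then obtain E where E: "\<And>k. E k \<subseteq> A" "\<And>k. compact_finite (E k)"
      "\<And>k a. a \<in> A \<Longrightarrow> \<exists>s\<in>E k. dist s a < inverse (real (Suc k))"
    by metis
  have "A \<subseteq> closure (\<Union>k. E k)"
  proof
    fix a assume a: "a \<in> A"
    show "a \<in> closure (\<Union>k. E k)"
      unfolding closure_approachable
    proof (intro allI impI)
      fix e :: real assume "0 < e"
      then obtain k where "inverse (real (Suc k)) < e" using reals_Archimedean by blast
      then show "\<exists>y\<in>\<Union>k. E k. dist y a < e" using E(3)[OF a, of k] by force
    qed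
  qed
  then show ?thesis using E(1,2) by (intro exI[of _ E] conjI allI)
qed

lemma infinite_compact_finite_subset:
  fixes A :: "'a::metric_space set"
  assumes "closed A" "\<not> compact A"
  shows "\<exists>S. S \<subseteq> A \<and> infinite S \<and> compact_finite S"
proof -
  obtain S where S: "infinite S" "S \<subseteq> A" "\<And>x. x \<in> A \<Longrightarrow> \<not> x islimpt S"
    using assms(2) unfolding compact_eq_Bolzano_Weierstrass by blast
  have "compact_finite S"
    unfolding compact_finite_def
  proof (intro allI impI, rule ccontr)
    fix K :: "'a set" assume "compact K" "infinite (K \<inter> S)"
    then obtain x where "x islimpt (K \<inter> S)"
      unfolding compact_eq_Bolzano_Weierstrass by (meson inf_le1)
    then have "x islimpt S" by (meson inf_le2 islimpt_subset)
    moreover have "x \<in> A"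
      using \<open>x islimpt S\<close> S(2) assms(1) closed_limpt islimpt_subset by blast
    ultimately show False using S(3) by blast
  qed
  then show ?thesis using S(1,2) by blast
qed

text \<open>An open set around the limit point \<open>x\<close> swallows all but finitely many of the finite sets.\<close>

lemma compact_shrinking_finite_sets:
  fixes x :: "'a::metric_space"
  assumes fin: "\<And>n. finite (P n)"
    and sub: "\<And>n. P n \<subseteq> cball x (inverse (real (Suc n)))"
  shows "compact (insert x (\<Union>n. P n))"
proof (rule compactI)
  fix \<C> assume op: "\<forall>t\<in>\<C>. open t" and cov: "insert x (\<Union>n. P n) \<subseteq> \<Union>\<C>"
  obtain t where t: "t \<in> \<C>" "x \<in> t" using cov by blast
  then obtain e where e: "e > 0" "ball x e \<subseteq> t" using op open_contains_ball by blast
  obtain m where m: "inverse (real (Suc m)) < e" using e(1) reals_Archimedean by blast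
  have tail: "P n \<subseteq> t" if "m \<le> n" for n
  proof -
    have "inverse (real (Suc n)) \<le> inverse (real (Suc m))"
      using that by (intro le_imp_inverse_le) auto
    then have "inverse (real (Suc n)) < e" using m by linarith
    then have "cball x (inverse (real (Suc n))) \<subseteq> ball x e" by auto
    then show ?thesis using sub e by blast
  qed
  have "finite (\<Union>n<m. P n)" using fin by blast
  moreover have "(\<Union>n<m. P n) \<subseteq> \<Union>\<C>" using cov by blast
  ultimately obtain \<F> where \<F>: "finite \<F>" "\<F> \<subseteq> \<C>" "(\<Union>n<m. P n) \<subseteq> \<Union>\<F>"
    using finite_subset_Union by metis
  have "P n \<subseteq> \<Union>(insert t \<F>)" for n
  proof (cases "m \<le> n")
    case False
    then have "P n \<subseteq> (\<Union>n<m. P n)" by (intro UN_upper) simp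
    then show ?thesis using \<F>(3) by auto
  qed (use tail in auto)
  then have "insert x (\<Union>n. P n) \<subseteq> \<Union>(insert t \<F>)" using t by blast
  then show "\<exists>\<C>'\<subseteq>\<C>. finite \<C>' \<and> insert x (\<Union>n. P n) \<subseteq> \<Union>\<C>'"
    using \<F> t by (intro exI[of _ "insert t \<F>"]) auto
qed

lemma not_locally_compact_point:
  assumes "\<not> locally_compact_space (euclidean :: 'a::metric_space topology)"
  obtains p :: "'a::metric_space" where "\<And>e. e > 0 \<Longrightarrow> \<not> compact (cball p e)"
proof -
  have "\<exists>p::'a. \<forall>e>0. \<not> compact (cball p e)"
  proof (rule ccontr)
    assume "\<not> ?thesis"
    then have "\<exists>e>0. compact (cball p e)" for p :: 'a by blast
    then have "\<exists>U K. openin euclidean U \<and> compactin euclidean K \<and> p \<in> U \<and> U \<subseteq> K" for p :: 'a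
      by (metis ball_subset_cball centre_in_ball compactin_euclidean_iff open_ball open_openin)
    then show False using assms unfolding locally_compact_space_def by blast
  qed
  then show ?thesis by (metis that)
qed

section \<open>Finite sequences coded by compact sets\<close>

lemma cofinal_le_trans:
  assumes "cofinal_le P leP Q leQ" "cofinal_le Q leQ R leR" "transp leR"
  shows "cofinal_le P leP R leR"
proof -
  obtain \<phi> \<psi> where \<phi>: "monotone_cofinal P leP Q leQ \<phi>" and \<psi>: "monotone_cofinal Q leQ R leR \<psi>"
    using assms unfolding cofinal_le_def by blast
  have \<phi>': "\<forall>p\<in>P. \<phi> p \<in> Q" "\<forall>q\<in>Q. \<exists>p\<in>P. leQ q (\<phi> p)"
    using \<phi> unfolding monotone_cofinal_def by auto
  have \<psi>': "\<forall>x\<in>Q. \<forall>y\<in>Q. leQ x y \<longrightarrow> leR (\<psi> x) (\<psi> y)" "\<forall>r\<in>R. \<exists>q\<in>Q. leR r (\<psi> q)"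
    using \<psi> unfolding monotone_cofinal_def monotone_on_def by auto
  have "\<exists>p\<in>P. leR r (\<psi> (\<phi> p))" if r: "r \<in> R" for r
  proof -
    obtain q where q: "q \<in> Q" "leR r (\<psi> q)" using \<psi>'(2) r by metis
    obtain p where p: "p \<in> P" "leQ q (\<phi> p)" using \<phi>'(2) q(1) by metis
    have "leR (\<psi> q) (\<psi> (\<phi> p))" using \<phi>'(1) \<psi>'(1) p q(1) by simp
    then show ?thesis using p(1) transpD[OF assms(3) q(2)] by metis
  qed
  then have "monotone_cofinal P leP R leR (\<psi> \<circ> \<phi>)"
    using \<phi> \<psi> unfolding monotone_cofinal_def monotone_on_def by (auto simp: image_subset_iff)
  then show ?thesis unfolding cofinal_le_def by blast
qed

lemma ordLeq_imp_covering_map: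
  assumes "|A| \<le>o |B|"
  obtains h where "A \<subseteq> h ` B"
proof -
  obtain f where f: "inj_on f A" "f ` A \<subseteq> B" using assms card_of_ordLeq by metis
  have "A \<subseteq> inv_into A f ` B"
  proof
    fix a assume "a \<in> A"
    then have "a = inv_into A f (f a)" "f a \<in> B" using f by auto
    then show "a \<in> inv_into A f ` B" by blast
  qed
  then show ?thesis using that by blast
qed

text \<open>
  The layers \<open>M k\<close> index pieces \<open>Q z\<close> of \<open>F\<close>, and the piece \<open>Q z\<close> is small enough to be coded by
  points near \<open>y z\<close>.  The hypothesis on countable sets says that a sequence of finite subsets of
  \<open>F\<close> always lives in a single piece.  A compact set that codes such a sequence consists of the
  index \<open>z\<close> of the piece, of the coding points near \<open>y z\<close>, and of the counters near \<open>p\<close>.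
\<close>

lemma compact_sets_cofinal_to_finite_sequences:
  fixes y :: "'a::metric_space \<Rightarrow> 'a" and Q :: "'a \<Rightarrow> 'b set" and M :: "nat \<Rightarrow> 'a set"
  assumes nlc: "\<not> locally_compact_space (euclidean :: 'a topology)"
    and M: "\<And>k. compact_finite (M k)"
    and Q: "\<And>z. |Q z| \<le>o local_density_at (y z)"
    and cover: "\<And>C. countable C \<Longrightarrow> C \<subseteq> F \<Longrightarrow> \<exists>z\<in>\<Union>k. M k. C \<subseteq> Q z"
  shows "cofinal_le {K :: 'a set. compact K} (\<subseteq>) {f :: nat \<Rightarrow> 'b set. \<forall>n. finite (f n) \<and> f n \<subseteq> F} (\<le>)"
proof -
  define r :: "nat \<Rightarrow> real" where "r n = inverse (real (Suc n))" for n
  have r: "r n > 0" for n by (simp add: r_def)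
  obtain p :: 'a where p: "\<And>e. e > 0 \<Longrightarrow> \<not> compact (cball p e)"
    using not_locally_compact_point[OF nlc] by blast
  have "\<exists>S. S \<subseteq> cball p (r n) \<and> infinite S \<and> compact_finite S" for n
    by (rule infinite_compact_finite_subset[OF closed_cball p[OF r]])
  then obtain S where S: "\<And>n. S n \<subseteq> cball p (r n)" "\<And>n. infinite (S n)" "\<And>n. compact_finite (S n)"
    by metis
  have "\<exists>E :: nat \<Rightarrow> 'a set. (\<forall>k. E k \<subseteq> cball (y z) (r n)) \<and> (\<forall>k. compact_finite (E k)) \<and>
      cball (y z) (r n) \<subseteq> closure (\<Union>k. E k)" for z n
    by (rule dense_layers)
  then obtain E :: "'a \<Rightarrow> nat \<Rightarrow> nat \<Rightarrow> 'a set" where E: "\<And>z n k. E z n k \<subseteq> cball (y z) (r n)" "\<And>z n k. compact_finite (E z n k)"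
      "\<And>z n. cball (y z) (r n) \<subseteq> closure (\<Union>k. E z n k)"
    by metis
  have "\<exists>h. Q z \<subseteq> h ` (\<Union>k. E z n k)" for z n
  proof -
    have "y z \<in> interior (cball (y z) (r n))"
      by (meson ball_subset_cball centre_in_ball interior_maximal open_ball r subsetD)
    then have "local_density_at (y z) \<le>o dens (cball (y z) (r n))"
      by (rule local_density_at_least)
    moreover have "dens (cball (y z) (r n)) \<le>o |\<Union>k. E z n k|"
      using E by (intro dens_least) blast+
    ultimately have "|Q z| \<le>o |\<Union>k. E z n k|"
      using Q ordLeq_transitive by blast
    then show ?thesis by (rule ordLeq_imp_covering_map) (rule exI)
  qed
  then obtain h where h: "\<And>z n. Q z \<subseteq> h z n ` (\<Union>k. E z n k)" by metis
  \<comment> \<open>The counter \<open>c n\<close> bounds the layers read at coordinate \<open>n\<close>; \<open>c 0\<close> also bounds the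
    layers \<open>M k\<close> of indices.  Sharing it is harmless, since counters may be arbitrarily large.\<close>
  define c where "c n K = card (K \<inter> S n)" for n K
  define I where "I K = (\<Union>k\<le>c 0 K. K \<inter> M k)" for K
  define \<Phi> where "\<Phi> K n = F \<inter> (\<Union>z\<in>I K. h z n ` (\<Union>k\<le>c n K. K \<inter> E z n k))" for K n
  have fin_layers: "finite (\<Union>k\<le>i. K \<inter> B k)"
    if "compact K" "\<And>k. compact_finite (B k)" for i :: nat and K :: "'a set" and B
    using that unfolding compact_finite_def by (intro finite_UN_I) simp_all
  have fin: "finite (\<Phi> K n)" if "compact K" for K n
    unfolding \<Phi>_def I_def
    by (intro finite_Int disjI2 finite_UN_I finite_imageI fin_layers that M E(2))
  have fin_S: "finite (K \<inter> S n)" if "compact K" for K n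
    using that S(3) by (simp add: compact_finite_def)
  have c_mono: "c n K \<le> c n L" if "compact L" "K \<subseteq> L" for n K L
    unfolding c_def using that by (intro card_mono fin_S Int_mono order_refl)
  have UN_mono_bound: "(\<Union>k\<le>i. K \<inter> B k) \<subseteq> (\<Union>k\<le>j. L \<inter> B k)"
    if "i \<le> j" "K \<subseteq> L" for i j :: nat and K L :: "'a set" and B
    using that by (intro SUP_subset_mono Int_mono order_refl) simp_all
  have I_mono: "I K \<subseteq> I L" if "compact L" "K \<subseteq> L" for K L
    unfolding I_def by (rule UN_mono_bound[OF c_mono[OF that] that(2)])
  have \<Phi>_mono: "\<Phi> K \<le> \<Phi> L" if L: "compact L" "K \<subseteq> L" for K L
  proof (rule le_funI)
    fix n
    have "h z n ` (\<Union>k\<le>c n K. K \<inter> E z n k) \<subseteq> h z n ` (\<Union>k\<le>c n L. L \<inter> E z n k)" for z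
      by (intro image_mono UN_mono_bound c_mono L)
    then show "\<Phi> K n \<subseteq> \<Phi> L n"
      unfolding \<Phi>_def by (intro Int_mono SUP_subset_mono I_mono L order_refl)
  qed
  have cof: "\<exists>K. compact K \<and> f \<le> \<Phi> K" if f: "\<And>n. finite (f n)" "\<And>n. f n \<subseteq> F" for f
  proof -
    have "countable (\<Union>n. f n)" using f by (simp add: countable_finite)
    moreover have "(\<Union>n. f n) \<subseteq> F" using f(2) by (rule UN_least)
    ultimately obtain z where "z \<in> (\<Union>k. M k)" and fzU: "(\<Union>n. f n) \<subseteq> Q z"
      using cover by metis
    then obtain k0 where z: "z \<in> M k0" by (elim UN_E)
    have fz: "f n \<subseteq> Q z" for n using fzU by (rule order_trans[OF UN_upper[OF UNIV_I]])
    have "\<exists>P m. finite P \<and> P \<subseteq> (\<Union>k\<le>m. E z n k) \<and> f n \<subseteq> h z n ` P" for n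
    proof -
      have "f n \<subseteq> h z n ` (\<Union>k. E z n k)" by (rule order_trans[OF fz h])
      then obtain P where P: "P \<subseteq> (\<Union>k. E z n k)" "finite P" "f n = h z n ` P"
        using finite_subset_image[OF f(1)] by metis
      then have "\<forall>x\<in>P. \<exists>k. x \<in> E z n k" by blast
      then obtain k where k: "\<And>x. x \<in> P \<Longrightarrow> x \<in> E z n (k x)" by metis
      have "k x \<le> Max (k ` P)" if "x \<in> P" for x using that P(2) by simp
      then have "P \<subseteq> (\<Union>j\<le>Max (k ` P). E z n j)" using k by auto
      then show ?thesis using P(2,3) by (intro exI[of _ P] exI[of _ "Max (k ` P)"]) simp
    qed
    then obtain P m where P: "\<And>n. finite (P n)" "\<And>n. P n \<subseteq> (\<Union>k\<le>m n. E z n k)"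
        "\<And>n. f n \<subseteq> h z n ` P n"
      by metis
    \<comment> \<open>The counter at \<open>n\<close> has to reach the layers of \<open>P n\<close> and, for \<open>n = 0\<close>, the layer of \<open>z\<close>.\<close>
    have "\<forall>n. \<exists>T. finite T \<and> card T = max k0 (m n) \<and> T \<subseteq> S n"
      by (intro allI infinite_arbitrarily_large S(2))
    from choice[OF this] obtain T
      where "\<forall>n. finite (T n) \<and> card (T n) = max k0 (m n) \<and> T n \<subseteq> S n" by (elim exE)
    then have T: "\<And>n. finite (T n)" "\<And>n. T n \<subseteq> S n" "\<And>n. card (T n) = max k0 (m n)"
      by simp_all
    define K where "K = insert z (insert (y z) (\<Union>n. P n) \<union> insert p (\<Union>n. T n))"
    have "P n \<subseteq> cball (y z) (r n)" for n
      by (rule order_trans[OF P(2)]) (intro UN_least E(1))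
    then have "compact (insert (y z) (\<Union>n. P n))"
      unfolding r_def by (intro compact_shrinking_finite_sets P(1))
    moreover have "T n \<subseteq> cball p (r n)" for n by (rule order_trans[OF T(2) S(1)])
    then have "compact (insert p (\<Union>n. T n))"
      unfolding r_def by (intro compact_shrinking_finite_sets T(1))
    ultimately have K: "compact K" unfolding K_def by (rule compact_insert[OF compact_Un])
    have c: "max k0 (m n) \<le> c n K" for n
    proof -
      have "card (T n) \<le> card (K \<inter> S n)"
        using T(2)[of n] by (intro card_mono fin_S[OF K]) (auto simp: K_def)
      then show ?thesis by (simp add: T(3) c_def)
    qed
    have zI: "z \<in> I K" using z c[of 0] by (auto simp: I_def K_def)
    have "f n \<subseteq> \<Phi> K n" for n
    proof -
      have "P n \<subseteq> (\<Union>k\<le>c n K. K \<inter> E z n k)"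
      proof
        fix w assume w: "w \<in> P n"
        then obtain k where "k \<le> m n" "w \<in> E z n k" using P(2)[of n] by auto
        moreover have "w \<in> K" using w by (auto simp: K_def)
        ultimately show "w \<in> (\<Union>k\<le>c n K. K \<inter> E z n k)" using c[of n] by auto
      qed
      then have "f n \<subseteq> h z n ` (\<Union>k\<le>c n K. K \<inter> E z n k)"
        by (rule order_trans[OF P(3) image_mono])
      then show ?thesis using f(2)[of n] zI unfolding \<Phi>_def by blast
    qed
    then show ?thesis using K by (auto simp: le_fun_def)
  qed
  have "monotone_cofinal {K :: 'a set. compact K} (\<subseteq>)
      {f :: nat \<Rightarrow> 'b set. \<forall>n. finite (f n) \<and> f n \<subseteq> F} (\<le>) \<Phi>"
    unfolding monotone_cofinal_def monotone_on_def
  proof (intro conjI ballI impI)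
    show "\<Phi> ` {K. compact K} \<subseteq> {f. \<forall>n. finite (f n) \<and> f n \<subseteq> F}"
      using fin by (auto simp: \<Phi>_def)
  qed (use \<Phi>_mono cof in auto)
  then show ?thesis unfolding cofinal_le_def by blast
qed

lemma countable_subset_in_underS:
  assumes r: "Card_order r" "uncountable_cofinality r" and C: "countable C" "C \<subseteq> Field r"
  obtains a where "a \<in> Field r" "C \<subseteq> underS r a"
proof -
  have "\<exists>a\<in>Field r. \<forall>b\<in>C. (a, b) \<notin> r"
  proof (rule ccontr)
    assume "\<not> ?thesis"
    then have "cofinality r \<le>o |C|"
      using cofinality_least[OF r(1) C(2)] by blast
    moreover have "|C| \<le>o natLeq"
      using C(1) by (simp add: countable_card_le_natLeq)
    ultimately have "cofinality r \<le>o natLeq" using ordLeq_transitive by blast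
    then show False
      using r(2) not_ordLess_ordLeq unfolding uncountable_cofinality_def by blast
  qed
  then obtain a where a: "a \<in> Field r" "\<And>b. b \<in> C \<Longrightarrow> (a, b) \<notin> r" by blast
  have "linear_order_on (Field r) r"
    using r(1) by (simp add: card_order_on_def well_order_on_def)
  then have tot: "\<And>b c. b \<in> Field r \<Longrightarrow> c \<in> Field r \<Longrightarrow> (b, c) \<in> r \<or> (c, b) \<in> r"
    unfolding linear_order_on_def total_on_def partial_order_on_def preorder_on_def refl_on_def
    by metis
  have "(b, a) \<in> r \<and> b \<noteq> a" if "b \<in> C" for b
  proof -
    have "(b, a) \<in> r" using tot[of a b] a that C(2) by blast
    then show ?thesis using a(2)[OF that] by blast
  qed
  then show ?thesis using that[OF a(1)] by (auto simp: underS_def)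
qed

text \<open>
  An initial segment has fewer than \<open>local_density\<close> elements, so its cardinality is not an upper
  bound of the local densities.  For \<open>a\<close> outside the field the segment is empty.
\<close>

lemma point_of_large_local_density:
  obtains y :: "'a::topological_space"
    where "|underS (local_density :: 'a rel) a| \<le>o local_density_at y"
proof (cases "a \<in> Field (local_density :: 'a rel)")
  case True
  have "\<exists>y::'a. |underS (local_density :: 'a rel) a| \<le>o local_density_at y"
  proof (rule ccontr)
    assume "\<not> ?thesis"
    then have "local_density_at y \<le>o |underS (local_density :: 'a rel) a|" for y :: 'a
      by (meson Card_order_local_density_at card_of_Well_order card_order_on_well_order_on ordLeq_total)
    then have "(local_density :: 'a rel) \<le>o |underS (local_density :: 'a rel) a|"
      by (intro local_density_least card_of_Card_order)
    moreover have "|underS (local_density :: 'a rel) a| <o (local_density :: 'a rel)"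
      using True by (intro card_of_underS Card_order_local_density)
    ultimately show False using not_ordLess_ordLeq by blast
  qed
  then show ?thesis using that by blast
next
  case False
  then have "underS (local_density :: 'a rel) a = {}"
    by (auto simp: underS_def Field_def)
  then show ?thesis using that[of undefined] by (simp add: Card_order_local_density_at card_of_empty1)
qed

text \<open>
  If the local density is realized at \<open>x\<close>, a single piece near \<open>x\<close> suffices.  Otherwise the pieces
  are the initial segments of \<open>\<kappa>\<close>.  They can be indexed by the dense union of the \<open>M k\<close> because
  it has at least \<open>\<kappa>\<close> points.
\<close>

lemma compact_sets_cofinal_to_Fin_seq:
  assumes nlc: "\<not> locally_compact_space (euclidean :: 'a::metric_space topology)"
    and eq: "dens (UNIV :: 'a::metric_space set) =o (local_density :: 'a rel)"
    and rc: "local_density_realized TYPE('a::metric_space) \<or> uncountable_cofinality (local_density :: 'a rel)"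
  shows "cofinal_le {K :: 'a::metric_space set. compact K} (\<subseteq>) (Fin_seq (dens (UNIV :: 'a::metric_space set))) (\<le>)"
proof -
  let ?ld = "local_density :: 'a rel" and ?F = "Field (dens (UNIV :: 'a set))"
  obtain M :: "nat \<Rightarrow> 'a set" where M: "\<And>k. compact_finite (M k)" "UNIV \<subseteq> closure (\<Union>k. M k)"
    using dense_layers[of UNIV] by blast
  have F: "|?F| =o dens (UNIV :: 'a set)" by (rule card_of_Field_ordIso[OF Card_order_dens])
  have F_ld: "|?F| =o ?ld" using F eq ordIso_transitive by blast
  have "\<exists>(y :: 'a \<Rightarrow> 'a) Q. (\<forall>z. |Q z| \<le>o local_density_at (y z)) \<and>
      (\<forall>C. countable C \<longrightarrow> C \<subseteq> ?F \<longrightarrow> (\<exists>z\<in>\<Union>k. M k. C \<subseteq> Q z))"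
    using rc
  proof
    assume "local_density_realized TYPE('a)"
    then obtain x :: 'a where "local_density_at x =o ?ld"
      unfolding local_density_realized_def by blast
    then have "|?F| \<le>o local_density_at x"
      using F_ld ordIso_imp_ordLeq ordIso_symmetric ordIso_transitive by blast
    moreover obtain z where "z \<in> (\<Union>k. M k)"
      using M(2) by (metis UNIV_I closure_empty empty_iff equals0I subset_empty)
    ultimately show ?thesis
      by (intro exI[of _ "\<lambda>_. x"] exI[of _ "\<lambda>_. ?F"]) blast
  next
    assume cf: "uncountable_cofinality ?ld"
    have "\<exists>y::'a. |underS ?ld a| \<le>o local_density_at y" for a
      by (rule point_of_large_local_density) blast
    then obtain y :: "'a \<Rightarrow> 'a" where y: "\<And>a. |underS ?ld a| \<le>o local_density_at (y a)" by metis
    have ld: "|Field ?ld| =o ?ld" by (rule card_of_Field_ordIso[OF Card_order_local_density])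
    have "|Field ?ld| =o |?F|" using ld F_ld ordIso_symmetric ordIso_transitive by blast
    then obtain b where b: "bij_betw b (Field ?ld) ?F" using card_of_ordIso by blast
    have "dens (UNIV :: 'a set) \<le>o |\<Union>k. M k|" using M(2) by (intro dens_least) auto
    then have "|Field ?ld| \<le>o |\<Union>k. M k|"
      using \<open>|Field ?ld| =o |?F|\<close> F ordIso_ordLeq_trans by blast
    then obtain g where g: "Field ?ld \<subseteq> g ` (\<Union>k. M k)" by (rule ordLeq_imp_covering_map)
    have "|b ` underS ?ld (g z)| \<le>o local_density_at (y (g z))" for z
      using card_of_image y ordLeq_transitive by blast
    moreover have "\<exists>z\<in>\<Union>k. M k. C \<subseteq> b ` underS ?ld (g z)" if C: "countable C" "C \<subseteq> ?F" for C
    proof -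
      have "C \<subseteq> b ` Field ?ld" using C(2) b by (simp add: bij_betw_def)
      then obtain C' where C': "C' \<subseteq> Field ?ld" "inj_on b C'" "C = b ` C'"
        by (meson subset_image_inj)
      then have "countable C'" using C(1) countable_image_inj_on by blast
      then obtain a where a: "a \<in> Field ?ld" "C' \<subseteq> underS ?ld a"
        by (rule countable_subset_in_underS[OF Card_order_local_density cf _ C'(1)])
      then obtain z where "z \<in> (\<Union>k. M k)" "a = g z" using g by blast
      then show ?thesis using a C' by blast
    qed
    ultimately show ?thesis
      by (intro exI[of _ "\<lambda>z. y (g z)"] exI[of _ "\<lambda>z. b ` underS ?ld (g z)"]) blast
  qed
  then obtain y :: "'a \<Rightarrow> 'a" and Q where "\<And>z. |Q z| \<le>o local_density_at (y z)"
      "\<And>C. countable C \<Longrightarrow> C \<subseteq> ?F \<Longrightarrow> \<exists>z\<in>\<Union>k. M k. C \<subseteq> Q z"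
    by blast
  from compact_sets_cofinal_to_finite_sequences[OF nlc M(1) this]
  show ?thesis unfolding Fin_seq_def .
qed

section \<open>Neighborhoods of zero in the compact-open topology\<close>

lemma zero_nhds_compact_open:
  fixes N :: "('a::metric_space, 'g::topological_group_add) cfun set"
  assumes "N \<in> nhds_id"
  obtains K U where "compact K" "open U" "0 \<in> U" "{g. apply_cfun g ` K \<subseteq> U} \<subseteq> N"
proof -
  let ?P = "\<lambda>N :: ('a, 'g) cfun set.
    \<exists>K U. compact K \<and> open U \<and> 0 \<in> U \<and> {g. apply_cfun g ` K \<subseteq> U} \<subseteq> N"
  have *: "?P S" if "generate_topology {{f :: ('a, 'g) cfun. apply_cfun f ` K \<subseteq> U} | K U. compact K \<and> open U} S"
    "0 \<in> S" for S
    using that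
  proof (induction S)
    case UNIV
    show ?case by (intro exI[of _ "{}"] exI[of _ UNIV]) auto
  next
    case (Int A B)
    then obtain K U L V where "compact K" "open U" "0 \<in> U" "{g. apply_cfun g ` K \<subseteq> U} \<subseteq> A"
      "compact L" "open V" "0 \<in> V" "{g. apply_cfun g ` L \<subseteq> V} \<subseteq> B"
      by blast
    then show ?case
      by (intro exI[of _ "K \<union> L"] exI[of _ "U \<inter> V"]) (auto simp: image_Un)
  next
    case (UN \<K>)
    then obtain A where A: "A \<in> \<K>" "0 \<in> A" by blast
    then obtain K U where "compact K" "open U" "0 \<in> U" "{g. apply_cfun g ` K \<subseteq> U} \<subseteq> A"
      using UN.IH[OF A] by metis
    moreover from this(4) A(1) have "{g. apply_cfun g ` K \<subseteq> U} \<subseteq> \<Union>\<K>" by (meson Union_upper subset_trans)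
    ultimately show ?case by metis
  next
    case (Basis S)
    then obtain K U where S: "S = {f. apply_cfun f ` K \<subseteq> U}" "compact K" "open U" by blast
    show ?case
    proof (cases "K = {}")
      case True
      then show ?thesis using S by (intro exI[of _ "{}"] exI[of _ UNIV]) auto
    next
      case False
      then have "0 \<in> U" using Basis(2) S(1) by (auto simp: zero_cfun.rep_eq)
      then show ?thesis using S by blast
    qed
  qed
  have N: "open (interior N)" "0 \<in> interior N" using assms by (auto simp: nhds_id_def)
  obtain K U where KU: "compact K" "open U" "0 \<in> U"
      "{g. apply_cfun g ` K \<subseteq> U} \<subseteq> interior N"
    using *[OF N(1)[unfolded open_cfun_def] N(2)] by (elim exE conjE)
  show ?thesis by (rule that[OF KU(1-3) order_trans[OF KU(4) interior_subset]])
qed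

lemma compact_open_nhd:
  fixes K :: "'a::metric_space set" and U :: "'g::topological_group_add set"
  assumes "compact K" "open U" "0 \<in> U"
  shows "{g. apply_cfun g ` K \<subseteq> U} \<in> nhds_id"
proof -
  have "0 \<in> {g. apply_cfun g ` K \<subseteq> U}" using assms by (auto simp: zero_cfun.rep_eq)
  then show ?thesis
    using open_cfun_subbasic[OF assms(1,2)] by (simp add: nhds_id_def interior_open)
qed

lemma metrizable_decreasing_base:
  fixes x :: "'g::topological_space"
  assumes "metrizable_space (euclidean :: 'g topology)"
  obtains W :: "nat \<Rightarrow> 'g set" where "\<And>m. open (W m)" "\<And>m. x \<in> W m" "decseq W"
    "\<And>U. open U \<Longrightarrow> x \<in> U \<Longrightarrow> \<exists>m. W m \<subseteq> U"
proof -
  obtain M d where Md: "Metric_space M d" "(euclidean :: 'g topology) = Metric_space.mtopology M d"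
    using assms unfolding metrizable_space_def by metis
  interpret Metric_space M d by (rule Md)
  have M: "M = UNIV" using Md(2) by (metis topspace_euclidean topspace_mtopology)
  have op: "open U \<longleftrightarrow> openin mtopology U" for U by (simp add: open_openin Md(2))
  define W where "W m = mball x (inverse (real (Suc m)))" for m
  show ?thesis
  proof (rule that[of W])
    show "open (W m)" for m unfolding op W_def by (rule openin_mball)
    show "x \<in> W m" for m unfolding W_def centre_in_mball_iff by (simp add: M)
    show "decseq W"
      unfolding decseq_def W_def
      by (intro allI impI mball_subset_concentric le_imp_inverse_le) auto
    fix U assume "open U" "x \<in> U"
    then obtain e where e: "e > 0" "mball x e \<subseteq> U" unfolding op openin_mtopology by metis
    obtain m where "inverse (real (Suc m)) < e" using reals_Archimedean[OF e(1)] by metis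
    then have "W m \<subseteq> mball x e" unfolding W_def by (intro mball_subset_concentric) simp
    then show "\<exists>m. W m \<subseteq> U" using e by blast
  qed
qed

lemma compact_INT_finite_UN_cball:
  fixes P :: "nat \<Rightarrow> 'a::complete_space set"
  assumes "\<And>n. finite (P n)"
  shows "compact (\<Inter>n. \<Union>d\<in>P n. cball d (inverse (real (Suc n))))" (is "compact ?K")
  unfolding compact_eq_totally_bounded
proof (intro conjI allI impI)
  have "closed ?K" using assms by blast
  then show "complete ?K" by (simp add: complete_eq_closed)
  fix e :: real assume "0 < e"
  then obtain n where n: "inverse (real (Suc n)) < e" using reals_Archimedean by blast
  then have "cball d (inverse (real (Suc n))) \<subseteq> ball d e" for d :: 'a by auto
  then have "(\<Union>d\<in>P n. cball d (inverse (real (Suc n)))) \<subseteq> (\<Union>d\<in>P n. ball d e)"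
    by (intro SUP_subset_mono order_refl)
  then have "?K \<subseteq> (\<Union>d\<in>P n. ball d e)" by (rule order_trans[OF INT_lower[OF UNIV_I]])
  then show "\<exists>k. finite k \<and> ?K \<subseteq> (\<Union>x\<in>k. ball x e)" using assms by metis
qed

text \<open>
  The coordinate \<open>f 0\<close> codes the zero neighborhood of \<open>G\<close> and the later ones code the compact set.
  Since \<open>X\<close> is infinite, every natural number is the size of a finite set of centres, so that all
  members of the decreasing base of \<open>G\<close> are reached.
\<close>

lemma Fin_seq_cofinal_to_nhds:
  assumes inf: "infinite (UNIV :: 'a::complete_space set)"
    and metr: "metrizable_space (euclidean :: 'g::topological_group_add topology)"
  shows "cofinal_le (Fin_seq (dens (UNIV :: 'a::complete_space set))) (\<le>)
    (nhds_id :: ('a, 'g::topological_group_add) cfun set set) (\<supseteq>)"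
proof -
  let ?F = "Field (dens (UNIV :: 'a set))"
  obtain D :: "'a set" where D: "UNIV \<subseteq> closure D" "dens (UNIV :: 'a set) =o |D|"
    using dens_attained[of "UNIV :: 'a set"] by blast
  have "|?F| =o |D|"
    using card_of_Field_ordIso[OF Card_order_dens] D(2) ordIso_transitive by blast
  then obtain b where b: "bij_betw b ?F D" using card_of_ordIso by blast
  have "infinite D"
  proof
    assume "finite D"
    then have "closure D = D" by (simp add: finite_imp_closed)
    then show False using D(1) inf \<open>finite D\<close> finite_subset by metis
  qed
  then have infF: "infinite ?F" using b bij_betw_finite by blast
  obtain W :: "nat \<Rightarrow> 'g set" where W: "\<And>m. open (W m)" "\<And>m. 0 \<in> W m" "decseq W"
      "\<And>U. open U \<Longrightarrow> 0 \<in> U \<Longrightarrow> \<exists>m. W m \<subseteq> U"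
    using metrizable_decreasing_base[OF metr, of 0] by blast
  define K where "K f = (\<Inter>n. \<Union>d\<in>b ` f (Suc n). cball d (inverse (real (Suc n))))" for f :: "nat \<Rightarrow> 'a set"
  define \<psi> where "\<psi> f = {g :: ('a, 'g) cfun. apply_cfun g ` K f \<subseteq> W (card (f 0))}" for f
  have nhd: "\<psi> f \<in> nhds_id" if "f \<in> Fin_seq (dens (UNIV :: 'a set))" for f
  proof -
    have "compact (K f)"
      unfolding K_def using that by (intro compact_INT_finite_UN_cball) (auto simp: Fin_seq_def)
    then show ?thesis unfolding \<psi>_def using W by (intro compact_open_nhd) auto
  qed
  have anti: "\<psi> f' \<subseteq> \<psi> f"
    if "f' \<in> Fin_seq (dens (UNIV :: 'a set))" and le: "f \<le> f'" for f f'
  proof -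
    have "K f \<subseteq> K f'"
    proof -
      have "b ` f (Suc n) \<subseteq> b ` f' (Suc n)" for n using le by (intro image_mono) (simp add: le_fun_def)
      then show ?thesis unfolding K_def by (intro INF_mono' SUP_subset_mono order_refl)
    qed
    moreover have "card (f 0) \<le> card (f' 0)"
      using that unfolding Fin_seq_def le_fun_def by (intro card_mono) auto
    then have "W (card (f' 0)) \<subseteq> W (card (f 0))" using W(3) by (simp add: decseq_def)
    ultimately show ?thesis unfolding \<psi>_def by blast
  qed
  have cof: "\<exists>f\<in>Fin_seq (dens (UNIV :: 'a set)). \<psi> f \<subseteq> N" if "N \<in> nhds_id" for N
  proof -
    obtain L U where L: "compact L" "open U" "0 \<in> U" "{g. apply_cfun g ` L \<subseteq> U} \<subseteq> N"
      by (rule zero_nhds_compact_open[OF \<open>N \<in> nhds_id\<close>])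
    obtain m where m: "W m \<subseteq> U" using W(4) L by blast
    obtain A where A: "finite A" "A \<subseteq> ?F" "card A = m"
      using infinite_arbitrarily_large[OF infF] by blast
    have "\<exists>P. finite P \<and> P \<subseteq> ?F \<and> L \<subseteq> (\<Union>d\<in>b ` P. cball d (inverse (real (Suc n))))" for n
    proof -
      have "L \<subseteq> (\<Union>d\<in>D. ball d (inverse (real (Suc n))))"
      proof
        fix x assume "x \<in> L"
        have "x \<in> closure D" using D(1) by blast
        then have "\<exists>d\<in>D. dist d x < inverse (real (Suc n))"
          unfolding closure_approachable by (metis inverse_positive_iff_positive of_nat_0_less_iff zero_less_Suc)
        then show "x \<in> (\<Union>d\<in>D. ball d (inverse (real (Suc n))))" by auto
      qed
      then obtain P where P: "P \<subseteq> D" "finite P" "L \<subseteq> (\<Union>d\<in>P. ball d (inverse (real (Suc n))))"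
        using compactE_image[OF L(1), of D "\<lambda>d. ball d (inverse (real (Suc n)))"] by blast
      then have "P \<subseteq> b ` ?F" using b by (simp add: bij_betw_def)
      then obtain P' where "P' \<subseteq> ?F" "finite P'" "P = b ` P'"
        using P(2) finite_subset_image by metis
      moreover have "L \<subseteq> (\<Union>d\<in>P. cball d (inverse (real (Suc n))))"
        using P(3) ball_subset_cball by blast
      ultimately show ?thesis by blast
    qed
    then obtain P where P: "\<And>n. finite (P n)" "\<And>n. P n \<subseteq> ?F"
        "\<And>n. L \<subseteq> (\<Union>d\<in>b ` P n. cball d (inverse (real (Suc n))))"
      by metis
    define f where "f = case_nat A P"
    have "f \<in> Fin_seq (dens (UNIV :: 'a set))"
      using A P unfolding Fin_seq_def f_def by (auto split: nat.splits)
    moreover have "L \<subseteq> K f" unfolding K_def f_def using P(3) by (intro INT_greatest) simp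
    then have "\<psi> f \<subseteq> N" using L(4) m A(3) unfolding \<psi>_def f_def by fastforce
    ultimately show ?thesis by blast
  qed
  have "monotone_cofinal (Fin_seq (dens (UNIV :: 'a set))) (\<le>)
      (nhds_id :: ('a, 'g) cfun set set) (\<supseteq>) \<psi>"
    unfolding monotone_cofinal_def monotone_on_def image_subset_iff
    by (intro conjI ballI impI nhd anti cof)
  then show ?thesis unfolding cofinal_le_def by (intro exI[of _ \<psi>])
qed

text \<open>
  If \<open>N\<close> contains \<open>[K,U]\<close>, then a function that vanishes on \<open>K\<close> is in \<open>N\<close>, so that the support
  of \<open>N\<close> defined in the proof is contained in \<open>K\<close>.  Conversely, the support of \<open>[K,U]\<close> contains
  \<open>K\<close> as soon as \<open>U\<close> omits the end point \<open>q 1\<close>: composing \<open>q\<close> with a bump at a point of \<open>K\<close>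
  gives a function outside \<open>[K,U]\<close>.
\<close>

lemma nhds_cofinal_to_compact_sets:
  fixes q :: "real \<Rightarrow> 'g::topological_group_add"
  assumes metr: "metrizable_space (euclidean :: 'g topology)"
    and q: "continuous_on {0..1} q" "q 0 = 0" "q 1 \<noteq> 0"
  shows "cofinal_le (nhds_id :: ('a::metric_space, 'g) cfun set set) (\<supseteq>) {K :: 'a set. compact K} (\<subseteq>)"
proof -
  define supp where "supp N = {x. \<forall>e>0. \<exists>g. g \<notin> N \<and> (\<forall>y. e \<le> dist x y \<longrightarrow> apply_cfun g y = 0)}"
    for N :: "('a, 'g) cfun set"
  have comp: "compact (supp N)" if N: "N \<in> nhds_id" for N
  proof -
    obtain K U where K: "compact K" "open U" "0 \<in> U" "{g. apply_cfun g ` K \<subseteq> U} \<subseteq> N"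
      by (rule zero_nhds_compact_open[OF N])
    have "supp N \<subseteq> K"
    proof
      fix x assume x: "x \<in> supp N"
      show "x \<in> K"
      proof (rule ccontr)
        assume "x \<notin> K"
        then have "\<exists>e>0. ball x e \<subseteq> - K"
          using compact_imp_closed[OF K(1)] open_contains_ball[of "- K"] by auto
        then obtain e where e: "e > 0" "ball x e \<subseteq> - K" by blast
        obtain g where g: "g \<notin> N" "\<And>y. e \<le> dist x y \<Longrightarrow> apply_cfun g y = 0"
          using x e(1) unfolding supp_def by auto
        have "apply_cfun g y = 0" if "y \<in> K" for y
        proof (rule g(2))
          have "y \<notin> ball x e" using e(2) that by blast
          then show "e \<le> dist x y" by simp
        qed
        then have "apply_cfun g ` K \<subseteq> U" using K(3) by auto
        then show False using K(4) g(1) by blast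
      qed
    qed
    moreover have "closed (supp N)"
      unfolding closure_subset_eq[symmetric]
    proof
      fix x assume "x \<in> closure (supp N)"
      then have lim: "\<forall>e>0. \<exists>y\<in>supp N. dist y x < e" by (simp add: closure_approachable)
      show "x \<in> supp N"
        unfolding supp_def
      proof (intro CollectI allI impI)
        fix e :: real assume "e > 0"
        then obtain y where y: "y \<in> supp N" "dist y x < e/2" using lim half_gt_zero by metis
        then have "\<exists>g. g \<notin> N \<and> (\<forall>w. e/2 \<le> dist y w \<longrightarrow> apply_cfun g w = 0)"
          using half_gt_zero[OF \<open>e > 0\<close>] unfolding supp_def by blast
        then obtain g where g: "g \<notin> N" "\<And>w. e/2 \<le> dist y w \<Longrightarrow> apply_cfun g w = 0"
          by blast
        have "e/2 \<le> dist y w" if "e \<le> dist x w" for w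
          using that y(2) dist_triangle[of x w y] by (simp add: dist_commute)
        then show "\<exists>g. g \<notin> N \<and> (\<forall>w. e \<le> dist x w \<longrightarrow> apply_cfun g w = 0)" using g by blast
      qed
    qed
    ultimately show ?thesis using K(1) by (metis compact_Int_closed inf.absorb_iff2)
  qed
  have mono: "supp N \<subseteq> supp N'" if "N' \<subseteq> N" for N N'
    using that unfolding supp_def by blast
  have cof: "\<exists>N\<in>nhds_id. K \<subseteq> supp N" if K: "compact K" for K
  proof -
    have "Hausdorff_space (euclidean :: 'g topology)"
      using metr metrizable_imp_Hausdorff_space by blast
    then obtain U where U: "open U" "0 \<in> U" "q 1 \<notin> U"
      using q(3) unfolding Hausdorff_space_def
      by (metis UNIV_I disjnt_iff open_openin topspace_euclidean)
    let ?N = "{g. apply_cfun g ` K \<subseteq> U}"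
    have "K \<subseteq> supp ?N"
    proof
      fix x assume x: "x \<in> K"
      show "x \<in> supp ?N"
        unfolding supp_def
      proof (intro CollectI allI impI)
        fix e :: real assume e: "e > 0"
        define u where "u y = max 0 (1 - dist x y / e)" for y
        have "continuous_on UNIV u" unfolding u_def by (intro continuous_intros) (use e in auto)
        moreover have u01: "u ` UNIV \<subseteq> {0..1}" using e by (auto simp: u_def)
        ultimately have "continuous_on UNIV (\<lambda>y. q (u y))"
          using continuous_on_compose2[OF q(1)] by blast
        then have g: "apply_cfun (Cfun (\<lambda>y. q (u y))) = (\<lambda>y. q (u y))"
          by (simp add: Cfun_inverse)
        have "u x = 1" by (simp add: u_def)
        then have "q 1 \<in> apply_cfun (Cfun (\<lambda>y. q (u y))) ` K" unfolding g using x by (metis image_eqI)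
        then have "Cfun (\<lambda>y. q (u y)) \<notin> ?N" using U(3) by blast
        moreover have "u y = 0" if "e \<le> dist x y" for y
          using that e by (simp add: u_def max_def field_simps)
        ultimately show "\<exists>g. g \<notin> ?N \<and> (\<forall>y. e \<le> dist x y \<longrightarrow> apply_cfun g y = 0)"
          using q(2) g by (intro exI[of _ "Cfun (\<lambda>y. q (u y))"]) simp
      qed
    qed
    then show ?thesis using compact_open_nhd[OF K U(1,2)] by blast
  qed
  have "monotone_cofinal (nhds_id :: ('a, 'g) cfun set set) (\<supseteq>) {K. compact K} (\<subseteq>) supp"
    unfolding monotone_cofinal_def monotone_on_def using comp mono cof by auto
  then show ?thesis unfolding cofinal_le_def by blast
qed

lemma arc_imp_path_from_zero:
  fixes A :: "'g::topological_group_add set"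
  assumes "A homeomorphic {0..1::real}"
  obtains q :: "real \<Rightarrow> 'g" where "continuous_on {0..1} q" "q 0 = 0" "q 1 \<noteq> 0"
proof -
  obtain h k where "homeomorphism {0..1::real} A h k"
    using assms homeomorphic_sym unfolding homeomorphic_def by metis
  then have h: "continuous_on {0..1} h" "\<And>x. x \<in> {0..1} \<Longrightarrow> k (h x) = x"
    by (auto simp: homeomorphism_def)
  have "h 1 \<noteq> h 0" using h(2)[of 0] h(2)[of 1] by auto
  then have "- h 0 + h 1 \<noteq> 0" by (metis add.inverse_inverse minus_unique)
  moreover have "continuous_on {0..1} (\<lambda>t. - h 0 + h t)" by (intro continuous_intros h)
  ultimately show ?thesis using that[of "\<lambda>t. - h 0 + h t"] by simp
qed

text \<open>The local base of the second part is the family of all neighborhoods of the identity.\<close>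

theorem theorem3p8:
  assumes not_locally_compact: "\<not> locally_compact_space (euclidean :: 'a::complete_space topology)"
    and density_eq: "dens (UNIV :: 'a::complete_space set) =o (local_density :: 'a rel)"
    and metrizable: "metrizable_space (euclidean :: 'g::topological_group_add topology)"
    and realized_or_cofinality:
      "local_density_realized TYPE('a::complete_space) \<or>
       uncountable_cofinality (local_density :: 'a rel)"
  shows
    "(\<exists>\<B> :: ('a::complete_space, 'g::topological_group_add) cfun set set.
        Fin_seq_base (dens (UNIV :: 'a set)) \<B>) \<and>
     ((\<exists>A :: 'g set. A homeomorphic {0..1::real}) \<longrightarrow>
       (\<exists>\<B> :: ('a, 'g) cfun set set. local_base_id \<B> \<and>
         cofinally_equivalent \<B> (\<supseteq>) (Fin_seq (dens (UNIV :: 'a set))) (\<le>)))"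
proof (intro conjI impI)
  have "infinite (UNIV :: 'a set)"
  proof
    assume fin: "finite (UNIV :: 'a set)"
    obtain p :: 'a where "\<And>e. e > 0 \<Longrightarrow> \<not> compact (cball p e)"
      using not_locally_compact_point[OF not_locally_compact] by blast
    moreover have "compact (cball p 1)"
      using fin by (meson finite_imp_compact finite_subset subset_UNIV)
    ultimately show False by simp
  qed
  from Fin_seq_cofinal_to_nhds[OF this metrizable]
  have base: "cofinal_le (Fin_seq (dens (UNIV :: 'a set))) (\<le>) (nhds_id :: ('a, 'g) cfun set set) (\<supseteq>)" .
  then show "\<exists>\<B> :: ('a, 'g) cfun set set. Fin_seq_base (dens (UNIV :: 'a set)) \<B>"
    unfolding Fin_seq_base_def cofinal_le_def by blast
  assume "\<exists>A :: 'g set. A homeomorphic {0..1::real}"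
  then obtain q :: "real \<Rightarrow> 'g" where q: "continuous_on {0..1} q" "q 0 = 0" "q 1 \<noteq> 0"
    using arc_imp_path_from_zero by metis
  have "cofinal_le (nhds_id :: ('a, 'g) cfun set set) (\<supseteq>) (Fin_seq (dens (UNIV :: 'a set))) (\<le>)"
    by (rule cofinal_le_trans[OF nhds_cofinal_to_compact_sets[OF metrizable q]
          compact_sets_cofinal_to_Fin_seq[OF not_locally_compact density_eq realized_or_cofinality]])
      simp
  then have "cofinally_equivalent (nhds_id :: ('a, 'g) cfun set set) (\<supseteq>)
      (Fin_seq (dens (UNIV :: 'a set))) (\<le>)"
    using base unfolding cofinally_equivalent_def by blast
  moreover have "local_base_id (nhds_id :: ('a, 'g) cfun set set)"
    unfolding local_base_id_def by blast
  ultimately show "\<exists>\<B> :: ('a, 'g) cfun set set. local_base_id \<B> \<and>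
      cofinally_equivalent \<B> (\<supseteq>) (Fin_seq (dens (UNIV :: 'a set))) (\<le>)"
    by blast
qed

end
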